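(* Let $k\ge 2$ and $r\ge 2$ be fixed integers. Then there exists a constant $C>0$ (depending only on $k$ and $r$) such that, asymptotically almost surely as $n\to\infty$, $$\chi\big(KG^r_{n,k}(1/2)\big)\ \le\ \frac{n}{r-1}-C\,(\log n)^{\frac{1}{r(k-1)}} .$$
   Context: The Kneser hypergraph $KG^r_{n,k}$ is the $r$-uniform hypergraph whose vertices are all $k$-element subsets of $[n]=\{1,\dots,n\}$ and whose edges are all $r$-tuples (as unordered collections) of pairwise disjoint $k$-sets. The random Kneser hypergraph $KG^r_{n,k}(p)$ has the same vertex set and contains each edge of $KG^r_{n,k}$ independently with probability $p$. $\chi$ denotes the chromatic number of a hypergraph: the least number of colours in a colouring of the vertices with no monochromatic edge. "Asymptotically almost surely" means with probability tending to $1$ as $n\to\infty$. *)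

theory Defs
  imports "HOL-Probability.Probability"
begin

type_synonym 'a hypergraph = "'a set \<times> 'a set set"

definition proper_colouring :: "'a hypergraph \<Rightarrow> nat \<Rightarrow> ('a \<Rightarrow> nat) \<Rightarrow> bool" where
  "proper_colouring H c f \<longleftrightarrow>
     f ` fst H \<subseteq> {..<c} \<and> (\<forall>e\<in>snd H. \<not> (\<exists>i. \<forall>v\<in>e. f v = i))"

text \<open>The minimum exists whenever the vertex set is finite and every edge has at least
  two vertices.\<close>

definition chromatic_number :: "'a hypergraph \<Rightarrow> nat" where
  "chromatic_number H = (LEAST c. \<exists>f. proper_colouring H c f)"

definition kneser_hypergraph :: "nat \<Rightarrow> nat \<Rightarrow> nat \<Rightarrow> nat set hypergraph" where
  "kneser_hypergraph r n k =
     (let V = {A. A \<subseteq> {1..n} \<and> card A = k}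
      in (V, {e. e \<subseteq> V \<and> card e = r \<and> pairwise disjnt e}))"

definition random_subhypergraph :: "'a hypergraph \<Rightarrow> real \<Rightarrow> 'a hypergraph pmf" where
  "random_subhypergraph H p =
     map_pmf (\<lambda>\<omega>. (fst H, {e \<in> snd H. \<omega> e})) (Pi_pmf (snd H) False (\<lambda>_. bernoulli_pmf p))"

definition random_kneser_hypergraph :: "nat \<Rightarrow> nat \<Rightarrow> nat \<Rightarrow> real \<Rightarrow> nat set hypergraph pmf" where
  "random_kneser_hypergraph r n k p = random_subhypergraph (kneser_hypergraph r n k) p"

end

theory Submission
  imports Defs "HOL-Real_Asymp.Real_Asymp"
begin

text \<open>The usual colouring of the Kneser hypergraph cuts the ground set into groups of \<open>r - 1\<close> points,
  lists the groups in some order, and gives a \<open>k\<close>-set the last group that it meets as its colour. A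
  monochromatic edge would consist of \<open>r\<close> disjoint sets that all meet one group of \<open>r - 1\<close> points.
  About \<open>n / (r - 1)\<close> colours suffice, one per group.

  In the random hypergraph some groups can have \<open>r\<close> points, and each such group covers one point
  more with the same colour. Let \<open>W\<close> be the union of the groups listed before a group \<open>G\<close> of \<open>r\<close>
  points. The colour of \<open>G\<close> is harmless unless the random hypergraph contains an edge inside
  \<open>W \<union> G\<close> all of whose sets meet \<open>G\<close>; such an edge is said here to cross \<open>G\<close>. The sets of a
  crossing edge contain one point of \<open>G\<close> each, so all the other \<open>r (k - 1)\<close> points lie in \<open>W\<close>
  (\<open>card_crossing_edges_le\<close>). If \<open>W\<close> has \<open>m\<close> points there are therefore at most \<open>m ^ (r (k - 1))\<close>
  such edges. For \<open>m\<close> half of \<open>(ln n) powr (1 / (r (k - 1)))\<close>, rounded down, they are all absent with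
  probability at least \<open>n powr (- 1/2)\<close>.

  Outside \<open>W\<close> there are about \<open>n / r\<close> disjoint candidates for \<open>G\<close>, and no edge crosses two of them.
  They succeed or fail independently, so all of them fail with probability at most about
  \<open>exp (- sqrt n / r)\<close>. This is so small that the union bound over all at most \<open>n ^ m\<close> sets \<open>W\<close> of
  \<open>m\<close> points is affordable (\<open>prob_chromatic_number_kneser\<close>); as it treats all \<open>W\<close> at once, each group
  may be chosen depending on the earlier ones. Asymptotically almost surely one can then choose about \<open>m / r\<close> groups of \<open>r\<close> points
  greedily, starting from the empty set, and continue with groups of \<open>r - 1\<close> points
  (\<open>chromatic_number_le_of_uncrossed_groups\<close>). Each of the \<open>T = m div r\<close> large groups saves
  \<open>1 / (r - 1)\<close> of a colour, and \<open>T\<close> has the order of \<open>(ln n) powr (1 / (r (k - 1)))\<close>.\<close>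

section \<open>Extending a colouring by one colour\<close>

definition induced_subhypergraph :: "'a set hypergraph \<Rightarrow> 'a set \<Rightarrow> 'a set hypergraph" where
  "induced_subhypergraph H U = ({A \<in> fst H. A \<subseteq> U}, {e \<in> snd H. \<Union>e \<subseteq> U})"

definition crossing_edges :: "'a set hypergraph \<Rightarrow> 'a set \<Rightarrow> 'a set \<Rightarrow> 'a set set set" where
  "crossing_edges H W G = {e \<in> snd H. \<Union>e \<subseteq> W \<union> G \<and> (\<forall>A\<in>e. A \<inter> G \<noteq> {})}"

lemma crossing_edges_mono: "W \<subseteq> W' \<Longrightarrow> crossing_edges H W G \<subseteq> crossing_edges H W' G"
  unfolding crossing_edges_def by blast

text \<open>The sets that meet \<open>G\<close> receive the new colour, whatever colour they had before. A monochromatic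
  edge in the new colour crosses \<open>G\<close>, and one in an old colour lies inside \<open>W\<close>.\<close>

lemma extend_colouring:
  assumes edges: "\<And>e. e \<in> snd H \<Longrightarrow> e \<subseteq> fst H"
    and none: "crossing_edges H W G = {}"
    and f: "proper_colouring (induced_subhypergraph H W) c f"
  shows "\<exists>f'. proper_colouring (induced_subhypergraph H (W \<union> G)) (Suc c) f'"
proof -
  define f' where "f' = (\<lambda>A. if A \<inter> G \<noteq> {} then c else f A)"
  have range: "f A < c" if "A \<in> fst H" "A \<subseteq> W" for A
    using f that by (auto simp: proper_colouring_def induced_subhypergraph_def)
  have avoid: "A \<subseteq> W" if "A \<subseteq> W \<union> G" "A \<inter> G = {}" for A
    using that by blast
  have "f' A < Suc c" if "A \<in> fst H" "A \<subseteq> W \<union> G" for A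
    using range[of A] avoid[of A] that by (auto simp: f'_def less_Suc_eq)
  moreover have False
    if e: "e \<in> snd H" "\<Union>e \<subseteq> W \<union> G" and mono: "\<And>A. A \<in> e \<Longrightarrow> f' A = i" for e i
  proof (cases "i = c")
    case True
    have "A \<inter> G \<noteq> {}" if "A \<in> e" for A
    proof
      assume "A \<inter> G = {}"
      moreover have "A \<in> fst H" "A \<subseteq> W \<union> G"
        using e edges that by auto
      ultimately show False
        using mono[OF that] True range[of A] avoid[of A] by (simp add: f'_def)
    qed
    then have "e \<in> crossing_edges H W G"
      using e by (auto simp: crossing_edges_def)
    with none show False by simp
  next
    case False
    then have G: "A \<inter> G = {}" if "A \<in> e" for A
      using mono[OF that] by (auto simp: f'_def split: if_splits)
    then have "\<Union>e \<subseteq> W"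
      using e(2) by blast
    moreover have "\<forall>A\<in>e. f A = i"
      using mono G by (auto simp: f'_def)
    ultimately show False
      using f e(1) by (auto simp: proper_colouring_def induced_subhypergraph_def)
  qed
  ultimately have "proper_colouring (induced_subhypergraph H (W \<union> G)) (Suc c) f'"
    unfolding proper_colouring_def induced_subhypergraph_def by fastforce
  then show ?thesis by blast
qed

section \<open>Crossing edges of a Kneser hypergraph\<close>

lemma fst_kneser: "fst (kneser_hypergraph r n k) = {A. A \<subseteq> {1..n} \<and> card A = k}"
  by (simp add: kneser_hypergraph_def Let_def)

lemma kneser_edgeD:
  assumes "e \<in> snd (kneser_hypergraph r n k)"
  shows "e \<subseteq> fst (kneser_hypergraph r n k)" "card e = r" "pairwise disjnt e"
  using assms by (auto simp: kneser_hypergraph_def Let_def)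

lemma finite_kneser_edges: "finite (snd (kneser_hypergraph r n k))"
proof (rule finite_subset)
  show "snd (kneser_hypergraph r n k) \<subseteq> Pow (Pow {1..n})"
    using kneser_edgeD(1) fst_kneser by blast
qed simp

text \<open>Disjoint sets pick different points of \<open>G\<close>. This forces \<open>G\<close> to have at least \<open>r\<close> points, and
  if it has exactly \<open>r\<close> then every set of the edge contains exactly one of them.\<close>

lemma crossing_edge_transversal:
  assumes e: "e \<in> crossing_edges (kneser_hypergraph r n k) W G"
  obtains h where "\<And>A. A \<in> e \<Longrightarrow> h A \<in> A \<inter> G" "inj_on h e"
proof -
  have "\<forall>A\<in>e. \<exists>g. g \<in> A \<inter> G"
    using e by (auto simp: crossing_edges_def)
  then obtain h where h: "\<And>A. A \<in> e \<Longrightarrow> h A \<in> A \<inter> G"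
    by metis
  moreover have "inj_on h e"
  proof (rule inj_onI, rule ccontr)
    fix A B assume AB: "A \<in> e" "B \<in> e" "h A = h B" "A \<noteq> B"
    have "pairwise disjnt e"
      using e kneser_edgeD(3) by (auto simp: crossing_edges_def)
    then have "A \<inter> B = {}"
      using AB by (auto simp: pairwise_def disjnt_def)
    then show False
      using h[OF AB(1)] h[OF AB(2)] AB(3) by auto
  qed
  ultimately show ?thesis using that by blast
qed

lemma crossing_edges_small:
  assumes "finite G" "card G < r"
  shows "crossing_edges (kneser_hypergraph r n k) W G = {}"
proof (rule equals0I)
  fix e assume e: "e \<in> crossing_edges (kneser_hypergraph r n k) W G"
  then obtain h where h: "\<And>A. A \<in> e \<Longrightarrow> h A \<in> A \<inter> G" "inj_on h e"
    by (rule crossing_edge_transversal) blast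
  have "card e \<le> card G"
    using h assms(1) by (intro card_inj_on_le[of h]) auto
  with assms(2) show False
    using e kneser_edgeD(2) by (auto simp: crossing_edges_def)
qed

text \<open>A crossing edge is determined by the function that maps each \<open>g \<in> G\<close> to the other \<open>k - 1\<close>
  points of the set containing \<open>g\<close>. Since these points avoid \<open>G\<close>, the exponent is \<open>r (k - 1)\<close>
  and not \<open>r k\<close>, which is where the exponent of the logarithm in the theorem comes from.\<close>

lemma card_crossing_edges_le:
  assumes W: "finite W" and G: "finite G" "card G = r"
  shows "card (crossing_edges (kneser_hypergraph r n k) W G) \<le> card W ^ (r * (k - 1))"
proof -
  define S where "S = {B. B \<subseteq> W \<and> card B = k - 1}"
  define F where "F = (\<lambda>\<phi>. (\<lambda>g. insert g (\<phi> g)) ` G)"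
  have "crossing_edges (kneser_hypergraph r n k) W G \<subseteq> F ` (G \<rightarrow>\<^sub>E S)"
  proof
    fix e assume e: "e \<in> crossing_edges (kneser_hypergraph r n k) W G"
    then obtain h where h: "\<And>A. A \<in> e \<Longrightarrow> h A \<in> A \<inter> G" "inj_on h e"
      by (rule crossing_edge_transversal) blast
    have e': "e \<subseteq> fst (kneser_hypergraph r n k)" "card e = r" "pairwise disjnt e"
        "\<Union>e \<subseteq> W \<union> G"
      using e kneser_edgeD by (auto simp: crossing_edges_def)
    \<comment> \<open>An injection between two sets of \<open>r\<close> elements is onto.\<close>
    have img: "h ` e = G"
      using h e'(2) G by (intro card_subset_eq) (auto simp: card_image)
    have trace: "A \<inter> G = {h A}" if A: "A \<in> e" for A
    proof -
      have "g = h A" if g: "g \<in> A \<inter> G" for g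
      proof -
        obtain B where B: "B \<in> e" "g = h B"
          using img g by auto
        then have "A = B"
          using e'(3) A h(1)[OF B(1)] g by (auto simp: pairwise_def disjnt_def)
        then show ?thesis using B by simp
      qed
      then show ?thesis using h(1)[OF A] by blast
    qed
    define \<phi> where "\<phi> = restrict (\<lambda>g. inv_into e h g - {g}) G"
    have inv: "inv_into e h (h A) = A" if "A \<in> e" for A
      using h(2) that by simp
    have "\<phi> \<in> G \<rightarrow>\<^sub>E S"
    proof (unfold \<phi>_def, rule restrict_PiE_iff[THEN iffD2], rule ballI)
      fix g assume "g \<in> G"
      then obtain A where A: "A \<in> e" "g = h A"
        using img by auto
      have "A - {h A} \<subseteq> W"
        using e'(4) A(1) trace[OF A(1)] by blast
      moreover have "card A = k"
        using A(1) e'(1) by (auto simp: fst_kneser)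
      ultimately show "inv_into e h g - {g} \<in> S"
        using A h(1)[OF A(1)] by (simp add: inv S_def)
    qed
    moreover have "e = F \<phi>"
    proof -
      have "F \<phi> = (\<lambda>A. insert (h A) (A - {h A})) ` e"
        by (auto simp: F_def \<phi>_def img[symmetric] inv image_image)
      also have "\<dots> = (\<lambda>A. A) ` e"
        using h(1) by (intro image_cong) auto
      finally show ?thesis by simp
    qed
    ultimately show "e \<in> F ` (G \<rightarrow>\<^sub>E S)" by blast
  qed
  moreover have fin: "finite (G \<rightarrow>\<^sub>E S)"
    using W G by (auto simp: S_def intro!: finite_PiE)
  ultimately have "card (crossing_edges (kneser_hypergraph r n k) W G) \<le> card (G \<rightarrow>\<^sub>E S)"
    by (meson card_image_le card_mono finite_imageI order_trans)
  also have "\<dots> = (card W choose (k - 1)) ^ r"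
    using W G by (simp add: card_PiE S_def n_subsets)
  also have "\<dots> \<le> (card W ^ (k - 1)) ^ r"
    by (cases "k - 1 \<le> card W") (auto simp: binomial_eq_0 intro!: power_mono binomial_le_pow)
  also have "\<dots> = card W ^ (r * (k - 1))"
    by (simp add: power_mult[symmetric] mult.commute)
  finally show ?thesis .
qed

text \<open>This gives the independence of the events that \<open>G\<close> and \<open>G'\<close> are crossed. It uses that an edge
  has at least one set: the empty edge would cross every group.\<close>

lemma disjoint_crossing_edges:
  assumes "G \<inter> W = {}" "G' \<inter> G = {}" "r > 0"
  shows "crossing_edges (kneser_hypergraph r n k) W G
       \<inter> crossing_edges (kneser_hypergraph r n k) W G' = {}"
proof (rule equals0I)
  fix e assume e: "e \<in> crossing_edges (kneser_hypergraph r n k) W G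
       \<inter> crossing_edges (kneser_hypergraph r n k) W G'"
  then have "card e = r"
    using kneser_edgeD(2) by (auto simp: crossing_edges_def)
  with assms(3) obtain A where A: "A \<in> e"
    by (cases "e = {}") auto
  then have "A \<subseteq> W \<union> G'" "A \<inter> G \<noteq> {}"
    using e by (auto simp: crossing_edges_def)
  with assms show False by blast
qed

section \<open>Colouring when uncrossed groups are available\<close>

text \<open>The first \<open>T\<close> colours are used on groups of \<open>r\<close> points and the others on groups of at most
  \<open>r - 1\<close> points, which no edge can cross. The hypothesis speaks only of sets \<open>W\<close> with exactly
  \<open>m\<close> points because an uncrossed group for \<open>W\<close> is also uncrossed for every subset of \<open>W\<close>. In the
  union bound below this leaves only the sets of \<open>m\<close> points to be counted.\<close>

lemma chromatic_number_le_of_uncrossed_groups: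
  assumes k: "k \<ge> 1" and r: "r \<ge> 2" and m: "m \<le> n" and T: "r * T \<le> m"
    and H: "fst H = fst (kneser_hypergraph r n k)" "snd H \<subseteq> snd (kneser_hypergraph r n k)"
    and groups: "\<And>W. W \<subseteq> {1..n} \<Longrightarrow> card W = m \<Longrightarrow>
      \<exists>G \<subseteq> {1..n} - W. card G = r \<and> crossing_edges H W G = {}"
  shows "chromatic_number H \<le> T + ((n - r * T) div (r - 1) + 1)"
proof -
  have edges: "e \<subseteq> fst H" if "e \<in> snd H" for e
    using that H kneser_edgeD(1)[of e r n k] by auto
  have crossing_small: "crossing_edges H W G = {}" if "finite G" "card G < r" for W G
    using crossing_edges_small[OF that, of n k W] H(2) by (auto simp: crossing_edges_def)
  have "\<exists>W f. W \<subseteq> {1..n} \<and> card W = r * t \<and>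
      proper_colouring (induced_subhypergraph H W) t f" if "t \<le> T" for t
    using that
  proof (induction t)
    case 0
    have no_vertex: "\<not> A \<subseteq> {}" if "A \<in> fst H" for A
      using that H(1) k by (auto simp: fst_kneser)
    moreover have "\<not> \<Union>e \<subseteq> {}" if "e \<in> snd H" for e
    proof
      assume "\<Union>e \<subseteq> {}"
      moreover have "card e = r"
        using that H(2) kneser_edgeD(2) by blast
      then obtain A where "A \<in> e"
        using r by (cases "e = {}") auto
      ultimately show False
        using no_vertex[of A] edges[OF that] by auto
    qed
    ultimately have "induced_subhypergraph H {} = ({}, {})"
      unfolding induced_subhypergraph_def by blast
    then show ?case
      by (intro exI[of _ "{}"]) (auto simp: proper_colouring_def)
  next
    case (Suc t)
    then obtain W f where W: "W \<subseteq> {1..n}" "card W = r * t"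
        "proper_colouring (induced_subhypergraph H W) t f"
      by auto
    have "r * t \<le> m"
      using Suc.prems T by (meson Suc_leD le_trans mult_le_mono2)
    \<comment> \<open>Pad the union of the groups so far to \<open>m\<close> points, to make the hypothesis applicable.\<close>
    then obtain W' where W': "W \<subseteq> W'" "W' \<subseteq> {1..n}" "card W' = m"
      using exists_subset_between[of W m "{1..n}"] W m by auto
    then obtain G where G: "G \<subseteq> {1..n} - W'" "card G = r" "crossing_edges H W' G = {}"
      using groups by blast
    have "crossing_edges H W G = {}"
      using crossing_edges_mono[OF W'(1)] G(3) by blast
    from extend_colouring[OF edges this W(3)]
    obtain f' where "proper_colouring (induced_subhypergraph H (W \<union> G)) (Suc t) f'"
      by auto
    moreover have "card (W \<union> G) = r * Suc t"
      using W W' G by (subst card_Un_disjoint) (auto intro: finite_subset)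
    moreover have "W \<union> G \<subseteq> {1..n}"
      using W(1) G(1) by auto
    ultimately show ?case by blast
  qed
  from this[of T] obtain W f where W: "W \<subseteq> {1..n}" "card W = r * T"
      "proper_colouring (induced_subhypergraph H W) T f"
    by auto
  have "\<exists>f. proper_colouring (induced_subhypergraph H {1..n}) (c + s) f"
    if "W \<subseteq> {1..n}" "card ({1..n} - W) \<le> (r - 1) * s"
      "proper_colouring (induced_subhypergraph H W) c f" for W c s f
    using that
  proof (induction s arbitrary: W c f)
    case 0
    then have "W = {1..n}" by auto
    with 0 show ?case by auto
  next
    case (Suc s)
    define U where "U = {1..n} - W"
    obtain G where G: "G \<subseteq> U" "card G = min (r - 1) (card U)" "finite G"
      using obtain_subset_with_card_n[of "min (r - 1) (card U)" U] by auto
    have "crossing_edges H W G = {}"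
      using G r by (intro crossing_small) auto
    from extend_colouring[OF edges this Suc.prems(3)]
    obtain f' where f': "proper_colouring (induced_subhypergraph H (W \<union> G)) (Suc c) f'"
      by auto
    have "{1..n} - (W \<union> G) = U - G"
      by (auto simp: U_def)
    moreover have "card (U - G) = card U - min (r - 1) (card U)"
      using G by (simp add: card_Diff_subset)
    moreover have "card U \<le> (r - 1) * Suc s"
      using Suc.prems(2) by (simp add: U_def)
    ultimately have "card ({1..n} - (W \<union> G)) \<le> (r - 1) * s"
      by (auto simp: min_def)
    moreover have "W \<union> G \<subseteq> {1..n}"
      using Suc.prems(1) G(1) by (auto simp: U_def)
    ultimately show ?case
      using Suc.IH[OF _ _ f'] by simp
  qed
  moreover have "card ({1..n} - W) \<le> (r - 1) * ((n - r * T) div (r - 1) + 1)"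
  proof -
    have "card ({1..n} - W) = n - r * T"
      using W by (simp add: card_Diff_subset finite_subset)
    moreover have "q \<le> (r - 1) * (q div (r - 1) + 1)" for q
      using r dividend_less_times_div[of "r - 1" q] by (simp only: distrib_left) simp
    ultimately show ?thesis by simp
  qed
  ultimately obtain f where f:
    "proper_colouring (induced_subhypergraph H {1..n}) (T + ((n - r * T) div (r - 1) + 1)) f"
    using W by blast
  have "induced_subhypergraph H {1..n} = H"
  proof -
    have "\<Union>e \<subseteq> {1..n}" if "e \<in> snd H" for e
      using edges[OF that] H(1) by (auto simp: fst_kneser)
    then show ?thesis
      using H(1) by (auto simp: induced_subhypergraph_def fst_kneser intro!: prod_eqI)
  qed
  then show ?thesis
    using f unfolding chromatic_number_def by (metis (mono_tags, lifting) Least_le)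
qed

section \<open>Uncrossed groups exist with high probability\<close>

text \<open>The events below are sets of functions on a type that may be infinite, so they can be
  uncountable. They are cut down to the countable supports before \<open>measure_pmf_prob_product\<close>
  is applied.\<close>

lemma prob_pair_pmf_Times:
  "measure_pmf.prob (pair_pmf M N) (A \<times> B) = measure_pmf.prob M A * measure_pmf.prob N B"
proof -
  have "measure_pmf.prob (pair_pmf M N) (A \<times> B)
      = measure_pmf.prob (pair_pmf M N) ((A \<inter> set_pmf M) \<times> (B \<inter> set_pmf N))"
    by (subst measure_Int_set_pmf[symmetric]) (simp add: Times_Int_Times)
  also have "\<dots> = measure_pmf.prob M (A \<inter> set_pmf M) * measure_pmf.prob N (B \<inter> set_pmf N)"
    by (intro measure_pmf_prob_product countable_Int2 countable_set_pmf)
  finally show ?thesis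
    by (simp add: measure_Int_set_pmf)
qed

text \<open>Disjoint blocks of independent coins are independent: the induction splits off the coins of
  one block as a separate factor of the product space.\<close>

lemma prob_each_block_hit:
  fixes p :: real and B :: "'i \<Rightarrow> 'a set"
  assumes p: "0 \<le> p" "p \<le> 1" and "finite E" "finite I"
    and "disjoint_family_on B I" "\<And>i. i \<in> I \<Longrightarrow> B i \<subseteq> E"
  shows "measure_pmf.prob (Pi_pmf E False (\<lambda>_. bernoulli_pmf p)) {\<omega>. \<forall>i\<in>I. \<exists>e\<in>B i. \<omega> e}
       = (\<Prod>i\<in>I. 1 - (1 - p) ^ card (B i))"
  using assms(4,3,5,6)
proof (induction I arbitrary: E rule: finite_induct)
  case empty
  then show ?case by simp
next
  case (insert j I)
  let ?P = "\<lambda>E. Pi_pmf E False (\<lambda>_. bernoulli_pmf p)"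
  define D where "D = B j"
  have D: "D \<subseteq> E" "finite D"
    using insert.prems by (auto simp: D_def intro: finite_subset)
  have BI: "B i \<subseteq> E - D" if "i \<in> I" for i
  proof -
    have "i \<noteq> j" using that insert.hyps by auto
    then have "B i \<inter> B j = {}"
      using insert.prems(2) that by (auto simp: disjoint_family_on_def)
    then show ?thesis
      using insert.prems(3)[of i] that by (auto simp: D_def)
  qed
  have "?P E = ?P (D \<union> (E - D))"
    using D by (simp add: Un_absorb1)
  also have "\<dots> = map_pmf (\<lambda>(f,g) x. if x \<in> D then f x else g x) (pair_pmf (?P D) (?P (E - D)))"
    using D insert.prems(1) by (intro Pi_pmf_union) auto
  finally have "measure_pmf.prob (?P E) {\<omega>. \<forall>i\<in>insert j I. \<exists>e\<in>B i. \<omega> e}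
    = measure_pmf.prob (pair_pmf (?P D) (?P (E - D)))
        ((\<lambda>(f,g) x. if x \<in> D then f x else g x) -` {\<omega>. \<forall>i\<in>insert j I. \<exists>e\<in>B i. \<omega> e})"
    by simp
  also have "(\<lambda>(f,g) x. if x \<in> D then f x else g x) -` {\<omega>. \<forall>i\<in>insert j I. \<exists>e\<in>B i. \<omega> e}
     = {\<omega>. \<exists>e\<in>D. \<omega> e} \<times> {\<omega>. \<forall>i\<in>I. \<exists>e\<in>B i. \<omega> e}"
  proof -
    have "(\<exists>e\<in>B i. if e \<in> D then f e else g e) = (\<exists>e\<in>B i. g e)"
      if "i \<in> I" for i and f g :: "'a \<Rightarrow> bool"
      using BI[OF that] by (intro bex_cong) auto
    moreover have "(\<exists>e\<in>D. if e \<in> D then f e else g e) = (\<exists>e\<in>D. f e)" for f g :: "'a \<Rightarrow> bool"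
      by (intro bex_cong) auto
    ultimately show ?thesis
      by (simp add: set_eq_iff D_def[symmetric] cong: ball_cong)
  qed
  also have "measure_pmf.prob (pair_pmf (?P D) (?P (E - D))) \<dots>
     = measure_pmf.prob (?P D) {\<omega>. \<exists>e\<in>D. \<omega> e} * (\<Prod>i\<in>I. 1 - (1 - p) ^ card (B i))"
    using insert.IH[of "E - D"] insert.prems BI
    by (simp add: prob_pair_pmf_Times disjoint_family_on_def)
  also have "measure_pmf.prob (?P D) {\<omega>. \<exists>e\<in>D. \<omega> e} = 1 - (1 - p) ^ card D"
  proof -
    have "measure_pmf.prob (?P D) {\<omega>. \<exists>e\<in>D. \<omega> e} = 1 - measure_pmf.prob (?P D) (Pi D (\<lambda>_. {False}))"
      by (subst measure_pmf.prob_compl[symmetric]) (auto intro!: arg_cong[where f = "measure_pmf.prob _"])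
    also have "measure_pmf.prob (?P D) (Pi D (\<lambda>_. {False})) = (1 - p) ^ card D"
      using D p by (subst measure_Pi_pmf_Pi) (auto simp: measure_pmf_single)
    finally show ?thesis .
  qed
  finally show ?case
    using insert.hyps by (simp add: D_def)
qed

lemma exists_disjoint_subsets_of_card:
  assumes "finite A" "r * N \<le> card A" "r > 0"
  shows "\<exists>\<G>. finite \<G> \<and> card \<G> = N \<and> pairwise disjnt \<G> \<and> (\<forall>G\<in>\<G>. G \<subseteq> A \<and> card G = r)"
  using assms(1,2)
proof (induction N arbitrary: A)
  case 0
  then show ?case by (intro exI[of _ "{}"]) auto
next
  case (Suc N)
  have "r \<le> card A" using Suc.prems(2) by simp
  then obtain G where G: "G \<subseteq> A" "card G = r" "finite G"
    by (rule obtain_subset_with_card_n)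
  have "r * N \<le> card (A - G)"
    using G Suc.prems by (simp add: card_Diff_subset)
  with Suc.IH[of "A - G"] Suc.prems(1) obtain \<G> where
    \<G>: "finite \<G>" "card \<G> = N" "pairwise disjnt \<G>" "\<forall>G'\<in>\<G>. G' \<subseteq> A - G \<and> card G' = r"
    by auto
  have "G \<notin> \<G>"
    using \<G>(4) G assms(3) by (metis Diff_disjoint card.empty inf.absorb_iff1 inf_commute less_irrefl)
  moreover have "pairwise disjnt (insert G \<G>)"
    using \<G>(3,4) by (auto simp: pairwise_insert disjnt_def)
  ultimately show ?case
    using \<G> G by (intro exI[of _ "insert G \<G>"]) auto
qed

text \<open>It suffices to look at \<open>(n - m) div r\<close> disjoint groups outside \<open>W\<close>, for which being crossed are
  independent events.\<close>

lemma prob_all_groups_crossed_le: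
  fixes p :: real and r n k :: nat
  defines "K \<equiv> kneser_hypergraph r n k"
  assumes p: "0 \<le> p" "p \<le> 1" and r: "r > 0" and W: "W \<subseteq> {1..n}" "card W = m"
  shows "measure_pmf.prob (Pi_pmf (snd K) False (\<lambda>_. bernoulli_pmf p))
      {\<omega>. \<forall>G \<subseteq> {1..n} - W. card G = r \<longrightarrow> (\<exists>e\<in>crossing_edges K W G. \<omega> e)}
    \<le> (1 - (1 - p) ^ (m ^ (r * (k - 1)))) ^ ((n - m) div r)"
proof -
  let ?P = "Pi_pmf (snd K) False (\<lambda>_. bernoulli_pmf p)"
  have finW: "finite W" using W(1) finite_subset by auto
  have "r * ((n - m) div r) \<le> card ({1..n} - W)"
    using W finW by (simp add: card_Diff_subset)
  then obtain \<G> where \<G>: "finite \<G>" "card \<G> = (n - m) div r" "pairwise disjnt \<G>"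
      "\<forall>G\<in>\<G>. G \<subseteq> {1..n} - W \<and> card G = r"
    using exists_disjoint_subsets_of_card[of "{1..n} - W" r "(n - m) div r"] r by auto
  have "measure_pmf.prob ?P
      {\<omega>. \<forall>G \<subseteq> {1..n} - W. card G = r \<longrightarrow> (\<exists>e\<in>crossing_edges K W G. \<omega> e)}
    \<le> measure_pmf.prob ?P {\<omega>. \<forall>G\<in>\<G>. \<exists>e\<in>crossing_edges K W G. \<omega> e}"
    using \<G>(4) by (intro measure_pmf.finite_measure_mono) auto
  also have "\<dots> = (\<Prod>G\<in>\<G>. 1 - (1 - p) ^ card (crossing_edges K W G))"
  proof (rule prob_each_block_hit[OF p _ \<G>(1)])
    show "finite (snd K)"
      by (simp add: K_def finite_kneser_edges)
    show "disjoint_family_on (crossing_edges K W) \<G>"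
      unfolding disjoint_family_on_def K_def
    proof (intro ballI impI)
      fix G G' assume "G \<in> \<G>" "G' \<in> \<G>" "G \<noteq> G'"
      then show "crossing_edges (kneser_hypergraph r n k) W G
          \<inter> crossing_edges (kneser_hypergraph r n k) W G' = {}"
        using \<G>(3,4) r by (intro disjoint_crossing_edges) (auto simp: pairwise_def disjnt_def)
    qed
  qed (auto simp: crossing_edges_def)
  also have "\<dots> \<le> (\<Prod>G\<in>\<G>. 1 - (1 - p) ^ (m ^ (r * (k - 1))))"
  proof (rule prod_mono, intro conjI)
    fix G assume "G \<in> \<G>"
    then have "finite G" "card G = r"
      using \<G>(4) by (auto intro: finite_subset)
    then have "card (crossing_edges K W G) \<le> m ^ (r * (k - 1))"
      using card_crossing_edges_le[OF finW] W(2) by (auto simp: K_def)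
    then show "1 - (1 - p) ^ card (crossing_edges K W G) \<le> 1 - (1 - p) ^ (m ^ (r * (k - 1)))"
      using p by (simp add: power_decreasing)
    show "0 \<le> 1 - (1 - p) ^ card (crossing_edges K W G)"
      using p by (simp add: power_le_one)
  qed
  finally show ?thesis
    using \<G>(2) by simp
qed

lemma prob_chromatic_number_kneser:
  fixes p :: real
  assumes p: "0 \<le> p" "p \<le> 1" and k: "k \<ge> 1" and r: "r \<ge> 2" and m: "m \<le> n" and T: "r * T \<le> m"
  shows "measure_pmf.prob (random_kneser_hypergraph r n k p)
      {H. chromatic_number H \<le> T + ((n - r * T) div (r - 1) + 1)}
    \<ge> 1 - real n ^ m * (1 - (1 - p) ^ (m ^ (r * (k - 1)))) ^ ((n - m) div r)"
proof -
  define K where "K = kneser_hypergraph r n k"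
  let ?P = "Pi_pmf (snd K) False (\<lambda>_. bernoulli_pmf p)"
  let ?\<W> = "{W. W \<subseteq> {1..n} \<and> card W = m}"
  let ?q = "(1 - (1 - p) ^ (m ^ (r * (k - 1)))) ^ ((n - m) div r)"
  define bad where "bad = (\<lambda>W. {\<omega>. \<forall>G \<subseteq> {1..n} - W. card G = r \<longrightarrow>
      (\<exists>e\<in>crossing_edges K W G. \<omega> e)})"
  define good where "good = {\<omega>. chromatic_number (fst K, {e \<in> snd K. \<omega> e})
      \<le> T + ((n - r * T) div (r - 1) + 1)}"
  have q: "0 \<le> ?q"
    using p by (intro zero_le_power) (simp add: power_le_one)
  have "\<omega> \<in> good" if "\<omega> \<notin> (\<Union>W\<in>?\<W>. bad W)" for \<omega>
    unfolding good_def mem_Collect_eq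
  proof (rule chromatic_number_le_of_uncrossed_groups[OF k r m T])
    fix W assume "W \<subseteq> {1..n}" "card W = m"
    then have "\<omega> \<notin> bad W" using that by blast
    then obtain G where "G \<subseteq> {1..n} - W" "card G = r" "\<not> (\<exists>e\<in>crossing_edges K W G. \<omega> e)"
      by (auto simp: bad_def)
    then show "\<exists>G \<subseteq> {1..n} - W. card G = r \<and> crossing_edges (fst K, {e \<in> snd K. \<omega> e}) W G = {}"
      by (intro exI[of _ G]) (auto simp: crossing_edges_def)
  qed (auto simp: K_def)
  then have "UNIV - good \<subseteq> (\<Union>W\<in>?\<W>. bad W)"
    by blast
  then have "measure_pmf.prob ?P (UNIV - good) \<le> measure_pmf.prob ?P (\<Union>W\<in>?\<W>. bad W)"
    by (intro measure_pmf.finite_measure_mono) auto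
  also have "\<dots> \<le> (\<Sum>W\<in>?\<W>. measure_pmf.prob ?P (bad W))"
    by (intro measure_pmf.finite_measure_subadditive_finite) auto
  also have "\<dots> \<le> (\<Sum>W\<in>?\<W>. ?q)"
    unfolding bad_def K_def
    using p r by (intro sum_mono prob_all_groups_crossed_le) auto
  also have "\<dots> = real (n choose m) * ?q"
    by (simp add: n_subsets)
  also have "\<dots> \<le> real n ^ m * ?q"
    using binomial_le_pow[OF m] q by (intro mult_right_mono) (simp_all flip: of_nat_power)
  finally have "1 - real n ^ m * ?q \<le> measure_pmf.prob ?P good"
    using measure_pmf.prob_compl[of good ?P] by simp
  also have "\<dots> = measure_pmf.prob (random_kneser_hypergraph r n k p)
      {H. chromatic_number H \<le> T + ((n - r * T) div (r - 1) + 1)}"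
    by (simp add: random_kneser_hypergraph_def random_subhypergraph_def K_def good_def vimage_def)
  finally show ?thesis .
qed

section \<open>Choice of parameters\<close>

lemma of_nat_div_ge: "real (a div b) \<ge> real a / real b - 1"
proof -
  have "\<lfloor>real a / real b\<rfloor> = int (a div b)"
    by (rule floor_divide_of_nat_eq)
  then show ?thesis by linarith
qed

theorem theorem3:
  fixes k r :: nat
  assumes "k \<ge> 2" and "r \<ge> 2"
  shows "\<exists>C::real. C > 0 \<and>
    (\<lambda>n::nat. measure_pmf.prob (random_kneser_hypergraph r n k (1/2))
        {H. real (chromatic_number H)
              \<le> real n / (real r - 1) - C * ln (real n) powr (1 / (real r * (real k - 1)))})
      \<longlonglongrightarrow> 1"
proof -
  define d where "d = r * (k - 1)"
  have d: "d > 0" "real r * (real k - 1) = real d"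
    using assms by (auto simp: d_def of_nat_diff)
  define R where "R = real r"
  have R: "R \<ge> 2" using assms by (simp add: R_def)
  define x where "x = (\<lambda>n::nat. ln (real n) powr (1 / real d))"
  define m where "m = (\<lambda>n. nat \<lfloor>x n / 2\<rfloor>)"
  define T where "T = (\<lambda>n. m n div r)"
  define C where "C = 1 / (4 * R * (R - 1))"
  have C: "C > 0" using R by (simp add: C_def)
  let ?event = "\<lambda>n. {H. real (chromatic_number H) \<le> real n / (R - 1) - C * x n}"
  \<comment> \<open>\<open>exp ((ln n) ^ 2)\<close> bounds the number \<open>n ^ m\<close> of sets in the union bound, as \<open>m \<le> ln n\<close>; the
      other factor bounds the probability that all groups outside one such set are crossed.\<close>
  define \<delta> where "\<delta> = (\<lambda>n::nat. exp (ln (real n) ^ 2 - real n powr (-1/2) * ((real n - ln (real n)) / R - 1)))"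
  have x_lim: "filterlim x at_top sequentially"
    unfolding x_def using d(1) by real_asymp
  have \<delta>: "\<delta> \<longlonglongrightarrow> 0"
    unfolding \<delta>_def using R by real_asymp
  have lower: "\<forall>\<^sub>F n in sequentially.
      1 - \<delta> n \<le> measure_pmf.prob (random_kneser_hypergraph r n k (1/2)) (?event n)"
  proof -
    \<comment> \<open>From this size of \<open>x n\<close> on, the saving \<open>T / (r - 1)\<close> outweighs the roundings.\<close>
    have ev1: "\<forall>\<^sub>F n in sequentially. x n \<ge> 8 * R * R"
      using x_lim by (auto simp: filterlim_at_top)
    have ev2: "\<forall>\<^sub>F n in sequentially. ln (real n) \<ge> 1 \<and> ln (real n) \<le> real n \<and> real n \<ge> 1"
      by (intro eventually_conj; real_asymp)
    from ev1 ev2 show ?thesis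
    proof eventually_elim
      case (elim n)
      define L where "L = ln (real n)"
      have L: "L \<ge> 1" "L \<le> real n" "n \<ge> 1"
        using elim by (auto simp: L_def)
      have x0: "x n \<ge> 0" by (simp add: x_def)
      have xd: "x n ^ d = L"
      proof -
        have "L powr (1 / real d) > 0"
          using L by simp
        then have "(L powr (1 / real d)) ^ d = (L powr (1 / real d)) powr real d"
          by (rule powr_realpow[symmetric])
        also have "\<dots> = L"
          using L d by (simp add: powr_powr)
        finally show ?thesis by (simp add: x_def L_def)
      qed
      have x_le: "x n \<le> L"
        using powr_mono[of "1 / real d" 1 L] L d by (simp add: x_def L_def)
      have m_le: "real (m n) \<le> x n / 2"
        unfolding m_def using x0 by linarith
      have m_ge: "real (m n) \<ge> x n / 2 - 1"
        unfolding m_def using x0 by linarith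
      \<comment> \<open>The factor 1/2 in the definition of \<open>m\<close> is there for this bound: it leaves \<open>sqrt n\<close> as a
          lower bound for \<open>n / 2 ^ (m ^ d)\<close>.\<close>
      have md: "real (m n ^ d) \<le> L / 2"
      proof -
        have "real (m n ^ d) \<le> (x n / 2) ^ d"
          using m_le by (simp add: power_mono)
        also have "\<dots> = L / 2 ^ d"
          by (simp add: power_divide xd)
        also have "\<dots> \<le> L / 2 ^ 1"
          using L d by (intro divide_left_mono power_increasing) auto
        finally show ?thesis by simp
      qed
      have m_n: "m n \<le> n" "real (m n) \<le> L"
        using m_le x_le L x0 by linarith+
      have rT: "r * T n \<le> m n"
        by (simp add: T_def)
      let ?q = "(1 - (1 - 1/2) ^ (m n ^ d)) ^ ((n - m n) div r) :: real"
      let ?bound = "T n + ((n - r * T n) div (r - 1) + 1)"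
      have "real n ^ m n * ?q \<le> \<delta> n"
      proof -
        have half: "(1/2::real) ^ (m n ^ d) \<ge> real n powr (-1/2)"
        proof -
          have "real n powr (-1/2) = exp (- (L / 2))"
            using L by (simp add: powr_def L_def)
          also have "\<dots> \<le> exp (- (real (m n ^ d) * ln 2))"
          proof -
            have "real (m n ^ d) * ln 2 \<le> real (m n ^ d) * 1"
              using ln_2_less_1 by (intro mult_left_mono) auto
            then show ?thesis using md by simp
          qed
          also have "\<dots> = exp (ln (1/2)) ^ (m n ^ d)"
            unfolding exp_of_nat_mult[symmetric] by (simp add: ln_div)
          finally show ?thesis by simp
        qed
        have groups: "real ((n - m n) div r) \<ge> (real n - L) / R - 1"
        proof -
          have "real ((n - m n) div r) \<ge> real (n - m n) / R - 1"
            using of_nat_div_ge[of "n - m n" r] unfolding R_def by linarith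
          moreover have "real (n - m n) / R \<ge> (real n - L) / R"
            using m_n R by (intro divide_right_mono) (auto simp: of_nat_diff)
          ultimately show ?thesis by linarith
        qed
        have "real n ^ m n = exp (real (m n) * L)"
          using L by (simp add: L_def exp_of_nat_mult)
        also have "\<dots> \<le> exp (L ^ 2)"
          using m_n L by (simp add: power2_eq_square mult_right_mono)
        finally have 1: "real n ^ m n \<le> exp (L ^ 2)" .
        have "?q \<le> exp (- ((1/2) ^ (m n ^ d))) ^ ((n - m n) div r)"
          using exp_ge_add_one_self[of "- ((1/2::real) ^ (m n ^ d))"]
          by (intro power_mono) (auto simp: power_le_one)
        also have "\<dots> = exp (- ((1/2) ^ (m n ^ d) * real ((n - m n) div r)))"
          by (simp add: exp_of_nat_mult[symmetric] mult.commute)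
        also have "\<dots> \<le> exp (- (real n powr (-1/2) * ((real n - L) / R - 1)))"
        proof -
          have "real n powr (-1/2) * ((real n - L) / R - 1)
              \<le> real n powr (-1/2) * real ((n - m n) div r)"
            using groups by (intro mult_left_mono) auto
          also have "\<dots> \<le> (1/2) ^ (m n ^ d) * real ((n - m n) div r)"
            using half by (intro mult_right_mono) auto
          finally show ?thesis by simp
        qed
        finally have 2: "?q \<le> exp (- (real n powr (-1/2) * ((real n - L) / R - 1)))" .
        have "real n ^ m n * ?q
            \<le> exp (L ^ 2) * exp (- (real n powr (-1/2) * ((real n - L) / R - 1)))"
          using 1 2 by (intro mult_mono zero_le_power) (auto simp: power_le_one)
        also have "\<dots> = \<delta> n"
          unfolding \<delta>_def L_def by (simp add: exp_add[symmetric])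
        finally show ?thesis .
      qed
      then have "1 - \<delta> n \<le> 1 - real n ^ m n * ?q"
        by simp
      also have "\<dots> \<le> measure_pmf.prob (random_kneser_hypergraph r n k (1/2))
          {H. chromatic_number H \<le> ?bound}"
        unfolding d_def using assms m_n rT
        by (intro prob_chromatic_number_kneser) auto
      also have "\<dots> \<le> measure_pmf.prob (random_kneser_hypergraph r n k (1/2)) (?event n)"
      proof (intro measure_pmf.finite_measure_mono subsetI; (unfold mem_Collect_eq)?)
        fix H :: "nat set hypergraph"
        assume "chromatic_number H \<le> ?bound"
        then have "real (chromatic_number H) \<le> real ?bound"
          by (rule of_nat_mono)
        also have "\<dots> \<le> real (T n) + ((real n - R * real (T n)) / (R - 1) + 1)"
        proof -
          have "real ((n - r * T n) div (r - 1)) \<le> real (n - r * T n) / real (r - 1)"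
            by (rule of_nat_div_le_of_nat)
          also have "\<dots> = (real n - R * real (T n)) / (R - 1)"
            using rT m_n assms by (simp add: R_def of_nat_diff)
          finally show ?thesis by simp
        qed
        also have "\<dots> = real n / (R - 1) - (real (T n) / (R - 1) - 1)"
        proof -
          have "real n - R * real (T n) = real n - real (T n) - real (T n) * (R - 1)"
            by (simp add: algebra_simps)
          then have "(real n - R * real (T n)) / (R - 1)
              = real n / (R - 1) - real (T n) / (R - 1) - real (T n)"
            using R by (simp only: diff_divide_distrib) simp
          then show ?thesis by simp
        qed
        also have "\<dots> \<le> real n / (R - 1) - C * x n"
        proof -
          have "real (T n) \<ge> real (m n) / R - 1"
            using of_nat_div_ge[of "m n" r] unfolding R_def T_def by linarith
          then have "R * real (T n) \<ge> real (m n) - R"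
            using R by (simp add: field_simps)
          moreover have "R * R \<ge> 1"
            using mult_mono[of 1 R 1 R] R by simp
          ultimately have "x n / 4 \<le> R * (real (T n) - (R - 1))"
            using m_ge elim(1) by (simp add: algebra_simps)
          then have "x n / 4 / (R * (R - 1)) \<le> R * (real (T n) - (R - 1)) / (R * (R - 1))"
            using R by (intro divide_right_mono) auto
          also have "\<dots> = real (T n) / (R - 1) - 1"
            using R by (simp add: diff_divide_distrib)
          finally show ?thesis
            by (simp add: C_def)
        qed
        finally show "real (chromatic_number H) \<le> real n / (R - 1) - C * x n" .
      qed simp
      finally show ?case .
    qed
  qed
  have "(\<lambda>n. measure_pmf.prob (random_kneser_hypergraph r n k (1/2)) (?event n)) \<longlonglongrightarrow> 1"
  proof (rule tendsto_sandwich[OF lower])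
    show "(\<lambda>n. 1 - \<delta> n) \<longlonglongrightarrow> 1"
      using tendsto_diff[OF tendsto_const[of 1] \<delta>] by simp
  qed auto
  then show ?thesis
    using C unfolding x_def R_def d(2) by blast
qed

end
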